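(* Let $\mathcal{A}$ be a commutative associative unital algebra generated by $\{g_i\}_{i=1}^m$, and let $(\mathcal{M},\rho)$ be a representation of $\mathcal{A}$ with $\rho(g_i)=\mathbf{S}_i\in\mathrm{End}(\mathcal{M})$ for all $i$. Let $(\mathcal{M},\tilde\rho)$ be a perturbed version of $(\mathcal{M},\rho)$ with $\tilde\rho(g_i)=\tilde{\mathbf{S}}_i=\mathbf{S}_i+\mathbf{T}(\mathbf{S}_i)\in\mathrm{End}(\mathcal{M})$ for all $i$. Then for every $p\in\mathcal{A}$ and every $\mathbf{x}\in\mathcal{M}$, $$\left\Vert p(\mathbf{S})\mathbf{x}-p(\tilde{\mathbf{S}})\mathbf{x}\right\Vert\le\Vert\mathbf{x}\Vert\sum_{i=1}^m\left(\left\Vert D_{p\vert\mathbf{S}_i}(\mathbf{S})\{\mathbf{T}(\mathbf{S}_i)\}\right\Vert+\mathcal{O}\left(\Vert\mathbf{T}(\mathbf{S}_i)\Vert^2\right)\right),$$ where $D_{p\vert\mathbf{S}_i}(\mathbf{S})$ is the partial Fréchet derivative of $p$ with respect to $\mathbf{S}_i$ at $\mathbf{S}=(\mathbf{S}_1,\ldots,\mathbf{S}_m)$.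
   Context: Setting. $\mathcal{M}$ is a vector space with inner product; $\mathcal{M}$ and $\mathcal{A}$ are over an algebraically closed field $\mathbb{F}$ (e.g. $\mathbb{C}$). A representation $(\mathcal{M},\rho)$ of $\mathcal{A}$ is $\mathcal{M}$ together with a homomorphism of unital algebras $\rho:\mathcal{A}\to\mathrm{End}(\mathcal{M})$. A set generates $\mathcal{A}$ if every $a\in\mathcal{A}$ is a polynomial in its elements. Every $a\in\mathcal{A}$ is written $a=p(g_1,\ldots,g_m)$ and identified with $p$ (writing $p\in\mathcal{A}$). For a tuple of operators $\mathbf{S}=(\mathbf{S}_1,\ldots,\mathbf{S}_m)$, $p(\mathbf{S})=\sum_{k_1,\ldots,k_m}h_{k_1\ldots k_m}\mathbf{S}_1^{k_1}\cdots\mathbf{S}_m^{k_m}$, so that $p$ is viewed as a map $\mathrm{End}(\mathcal{M})^m\to\mathrm{End}(\mathcal{M})$; $\rho(a)=p(\mathbf{S})$. Perturbation. $\tilde{\mathbf{S}}=(\tilde{\mathbf{S}}_1,\ldots,\tilde{\mathbf{S}}_m)$ with $\tilde{\mathbf{S}}_i=\mathbf{S}_i+\mathbf{T}(\mathbf{S}_i)$, $\mathbf{T}(\mathbf{S}_i)\in\mathrm{End}(\mathcal{M})$, and $\tilde\rho(a)=p(\tilde{\mathbf{S}})$ ($\tilde\rho$ is not required to be a homomorphism). Norms and derivative. Operators on $\mathcal{M}$ are understood as bounded, with $\Vert\cdot\Vert$ the operator norm. $D_{p\vert\mathbf{S}_i}(\mathbf{S})$ is the Fréchet derivative at $\mathbf{S}_i$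 of $p$ as a function of its $i$th operator argument, the others being held fixed. The $\mathcal{O}$ terms are for $\mathbf{T}(\mathbf{S}_1),\ldots,\mathbf{T}(\mathbf{S}_m)\to0$ with $p$ and $\mathbf{S}$ fixed, uniformly in $\mathbf{x}$. *)

theory Defs
  imports "HOL-Analysis.Analysis" "HOL-Library.Poly_Mapping" "HOL-Library.Landau_Symbols"
begin

section \<open>Complex vector spaces, algebras and inner product spaces\<close>

class complex_vector = real_vector +
  fixes scaleC :: "complex \<Rightarrow> 'a \<Rightarrow> 'a"  (infixr "*\<^sub>C" 75)
  assumes scaleC_add_right: "c *\<^sub>C (x + y) = c *\<^sub>C x + c *\<^sub>C y"
    and scaleC_add_left: "(c + d) *\<^sub>C x = c *\<^sub>C x + d *\<^sub>C x"
    and scaleC_scaleC: "c *\<^sub>C d *\<^sub>C x = (c * d) *\<^sub>C x"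
    and scaleC_one: "1 *\<^sub>C x = x"
    and scaleR_scaleC: "r *\<^sub>R x = complex_of_real r *\<^sub>C x"

text \<open>Associative unital algebras. The class \<^class>\<open>monoid_mult\<close> is used instead of
  \<^class>\<open>ring_1\<close> because the latter excludes the zero algebra.\<close>

class complex_unital_algebra = complex_vector + ring + monoid_mult +
  assumes mult_scaleC_left: "(c *\<^sub>C x) * y = c *\<^sub>C (x * y)"
    and mult_scaleC_right: "x * (c *\<^sub>C y) = c *\<^sub>C (x * y)"

text \<open>Every complex inner product space is a real one with inner product
  \<open>Re \<langle>x, y\<rangle>\<close>, which has the same norm. Basing the class on
  \<^class>\<open>real_inner\<close> yields the norm, the topology and positive definiteness.
  Completeness is not required.\<close>

class complex_inner = complex_vector + real_inner +
  fixes cinner :: "'a \<Rightarrow> 'a \<Rightarrow> complex"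
  assumes cinner_commute: "cinner x y = cnj (cinner y x)"
    and cinner_add_left: "cinner (x + y) z = cinner x z + cinner y z"
    and cinner_scaleC_left: "cinner (c *\<^sub>C x) y = c * cinner x y"
    and inner_eq_Re_cinner: "inner x y = Re (cinner x y)"

instantiation complex :: complex_inner
begin

definition scaleC_complex :: "complex \<Rightarrow> complex \<Rightarrow> complex"
  where "scaleC_complex c x = c * x"

definition cinner_complex :: "complex \<Rightarrow> complex \<Rightarrow> complex"
  where "cinner_complex x y = x * cnj y"

instance
  by standard
    (simp_all add: scaleC_complex_def cinner_complex_def inner_complex_def algebra_simps
      scaleR_conv_of_real)

end


section \<open>The algebra of bounded complex-linear operators\<close>

lemma scaleC_zero_right: "c *\<^sub>C (0::'a::complex_vector) = 0"
  by (metis add_cancel_right_right scaleC_add_right)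

typedef (overloaded) 'a endo =
  "{f :: 'a::complex_inner \<Rightarrow>\<^sub>L 'a. \<forall>c x. blinfun_apply f (c *\<^sub>C x) = c *\<^sub>C blinfun_apply f x}"
  morphisms blinfun_of_endo Abs_endo
  by (intro exI[of _ 0]) (simp add: scaleC_zero_right)

setup_lifting type_definition_endo

lift_definition endo_apply :: "'a::complex_inner endo \<Rightarrow> 'a \<Rightarrow> 'a" is blinfun_apply .

lemma scaleC_minus_right: "c *\<^sub>C (- x) = - (c *\<^sub>C (x::'a::complex_vector))"
  by (metis add.right_inverse add_eq_0_iff scaleC_add_right scaleC_zero_right)

lemma scaleC_diff_right: "c *\<^sub>C (x - y) = c *\<^sub>C x - c *\<^sub>C (y::'a::complex_vector)"
  by (metis diff_conv_add_uminus scaleC_add_right scaleC_minus_right)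

lemma norm_scaleC: "norm (c *\<^sub>C x) = cmod c * norm (x::'a::complex_inner)"
proof -
  have "cinner (c *\<^sub>C x) (c *\<^sub>C x) = complex_of_real ((cmod c)\<^sup>2) * cinner x x"
    by (metis cinner_commute cinner_scaleC_left complex_cnj_mult complex_norm_square mult.assoc
        mult.left_commute)
  then have "(norm (c *\<^sub>C x))\<^sup>2 = (cmod c * norm x)\<^sup>2"
    by (simp add: power2_norm_eq_inner inner_eq_Re_cinner power_mult_distrib)
  then show ?thesis
    by (simp add: power2_eq_iff_nonneg)
qed

lemma bounded_linear_scaleC: "bounded_linear ((*\<^sub>C) c :: 'a::complex_inner \<Rightarrow> 'a)"
  by (rule bounded_linear_intro[where K = "cmod c"])
    (simp_all add: scaleC_add_right norm_scaleC scaleR_scaleC scaleC_scaleC mult.commute)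

instantiation endo :: (complex_inner) "{real_normed_algebra, complex_unital_algebra}"
begin

lift_definition zero_endo :: "'a endo" is 0
  by (simp add: scaleC_zero_right)

lift_definition one_endo :: "'a endo" is id_blinfun
  by simp

lift_definition plus_endo :: "'a endo \<Rightarrow> 'a endo \<Rightarrow> 'a endo" is "(+)"
  by (simp add: blinfun.add_left scaleC_add_right)

lift_definition uminus_endo :: "'a endo \<Rightarrow> 'a endo" is uminus
  by (simp add: blinfun.minus_left scaleC_minus_right)

lift_definition minus_endo :: "'a endo \<Rightarrow> 'a endo \<Rightarrow> 'a endo" is "(-)"
  by (simp add: blinfun.diff_left scaleC_diff_right)

lift_definition times_endo :: "'a endo \<Rightarrow> 'a endo \<Rightarrow> 'a endo" is "(o\<^sub>L)"
  by simp

lift_definition scaleR_endo :: "real \<Rightarrow> 'a endo \<Rightarrow> 'a endo" is scaleR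
  by (simp add: blinfun.scaleR_left scaleR_scaleC scaleC_scaleC mult.commute)

lift_definition scaleC_endo :: "complex \<Rightarrow> 'a endo \<Rightarrow> 'a endo"
  is "\<lambda>c f. Blinfun ((*\<^sub>C) c) o\<^sub>L f"
  by (simp add: bounded_linear_Blinfun_apply bounded_linear_scaleC scaleC_scaleC mult.commute)

text \<open>The operator norm.\<close>

lift_definition norm_endo :: "'a endo \<Rightarrow> real" is norm .

definition dist_endo :: "'a endo \<Rightarrow> 'a endo \<Rightarrow> real"
  where "dist_endo f g = norm (f - g)"

definition sgn_endo :: "'a endo \<Rightarrow> 'a endo"
  where "sgn_endo f = inverse (norm f) *\<^sub>R f"

definition uniformity_endo :: "('a endo \<times> 'a endo) filter"
  where "uniformity_endo = (INF e\<in>{0 <..}. principal {(x, y). dist x y < e})"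

definition open_endo :: "'a endo set \<Rightarrow> bool"
  where "open_endo U = (\<forall>x\<in>U. eventually (\<lambda>(x', y). x' = x \<longrightarrow> y \<in> U) uniformity)"

instance
proof
  fix f g h :: "'a endo" and a b :: real and c d :: complex and U :: "'a endo set"
  show "f + g + h = f + (g + h)" "f + g = g + f" "0 + f = f" "- f + f = 0" "f - g = f + - g"
    by (transfer; simp)+
  show "a *\<^sub>R (f + g) = a *\<^sub>R f + a *\<^sub>R g" "(a + b) *\<^sub>R f = a *\<^sub>R f + b *\<^sub>R f"
    "a *\<^sub>R b *\<^sub>R f = (a * b) *\<^sub>R f" "1 *\<^sub>R f = f"
    by (transfer; simp add: algebra_simps)+
  show "f * g * h = f * (g * h)" "1 * f = f" "f * 1 = f"
    "(f + g) * h = f * h + g * h" "f * (g + h) = f * g + f * h"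
    "a *\<^sub>R f * g = a *\<^sub>R (f * g)" "f * a *\<^sub>R g = a *\<^sub>R (f * g)"
    by (transfer; auto intro!: blinfun_eqI simp: blinfun.bilinear_simps)+
  show "c *\<^sub>C (f + g) = c *\<^sub>C f + c *\<^sub>C g" "(c + d) *\<^sub>C f = c *\<^sub>C f + d *\<^sub>C f"
    "c *\<^sub>C d *\<^sub>C f = (c * d) *\<^sub>C f" "1 *\<^sub>C f = f" "a *\<^sub>R f = complex_of_real a *\<^sub>C f"
    "c *\<^sub>C f * g = c *\<^sub>C (f * g)" "f * c *\<^sub>C g = c *\<^sub>C (f * g)"
    by (transfer; auto intro!: blinfun_eqI simp: blinfun.bilinear_simps
        bounded_linear_Blinfun_apply bounded_linear_scaleC scaleC_add_right scaleC_add_left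
        scaleC_scaleC scaleC_one scaleR_scaleC)+
  show "dist f g = norm (f - g)"
    by (rule dist_endo_def)
  show "sgn f = inverse (norm f) *\<^sub>R f"
    by (rule sgn_endo_def)
  show "uniformity = (INF e\<in>{0 <..}. principal {(x, y :: 'a endo). dist x y < e})"
    by (rule uniformity_endo_def)
  show "open U = (\<forall>x\<in>U. \<forall>\<^sub>F (x', y) in uniformity. x' = x \<longrightarrow> y \<in> U)"
    by (rule open_endo_def)
  show "(norm f = 0) = (f = 0)" "norm (f + g) \<le> norm f + norm g"
    "norm (a *\<^sub>R f) = \<bar>a\<bar> * norm f"
    by (transfer; simp add: norm_triangle_ineq)+
  show "norm (f * g) \<le> norm f * norm g"
    by transfer (rule norm_blinfun_compose)
qed

end


section \<open>Polynomials, representations and partial derivatives\<close>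

text \<open>A polynomial in the indeterminates with indices \<open>1, \<dots>, m\<close> maps each exponent
  vector \<open>k\<close> to its coefficient \<open>h\<^sub>k\<close>.\<close>

definition polys :: "nat \<Rightarrow> ((nat \<Rightarrow>\<^sub>0 nat) \<Rightarrow>\<^sub>0 complex) set"
  where "polys m = {p. \<forall>k\<in>Poly_Mapping.keys p. Poly_Mapping.keys k \<subseteq> {1..m}}"

text \<open>The factors need not commute: they are multiplied in the order \<open>1, \<dots>, m\<close>.\<close>

definition poly_eval ::
    "nat \<Rightarrow> ((nat \<Rightarrow>\<^sub>0 nat) \<Rightarrow>\<^sub>0 complex) \<Rightarrow> (nat \<Rightarrow> 'b::complex_unital_algebra) \<Rightarrow> 'b"
  where "poly_eval m p S =
    (\<Sum>k\<in>Poly_Mapping.keys p.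
      Poly_Mapping.lookup p k *\<^sub>C (\<Prod>i\<leftarrow>[1..<Suc m]. S i ^ Poly_Mapping.lookup k i))"

definition generates :: "nat \<Rightarrow> (nat \<Rightarrow> 'b::complex_unital_algebra) \<Rightarrow> bool"
  where "generates m g \<longleftrightarrow> (\<forall>a. \<exists>p\<in>polys m. a = poly_eval m p g)"

definition unital_algebra_hom ::
    "('b::complex_unital_algebra \<Rightarrow> 'c::complex_unital_algebra) \<Rightarrow> bool"
  where "unital_algebra_hom \<rho> \<longleftrightarrow>
    (\<forall>a b. \<rho> (a + b) = \<rho> a + \<rho> b) \<and> (\<forall>c a. \<rho> (c *\<^sub>C a) = c *\<^sub>C \<rho> a) \<and>
    (\<forall>a b. \<rho> (a * b) = \<rho> a * \<rho> b) \<and> \<rho> 1 = 1"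

text \<open>\<^const>\<open>frechet_derivative\<close> is the derivative over the reals, which coincides with
  the complex one wherever the latter exists, hence for polynomials.\<close>

definition partial_frechet ::
    "((nat \<Rightarrow> 'b::real_normed_vector) \<Rightarrow> 'c::real_normed_vector) \<Rightarrow> nat \<Rightarrow> (nat \<Rightarrow> 'b) \<Rightarrow> 'b \<Rightarrow> 'c"
  where "partial_frechet f i S = frechet_derivative (\<lambda>X. f (S(i := X))) (at (S i))"

text \<open>The filter \<open>T\<^sub>1, \<dots>, T\<^sub>m \<rightarrow> 0\<close> on tuples (the zero tuple itself is not excluded).\<close>

definition tuple_to_zero :: "nat \<Rightarrow> (nat \<Rightarrow> 'b::real_normed_vector) filter"
  where "tuple_to_zero m = (INF j\<in>{1..m}. filtercomap (\<lambda>T. T j) (nhds 0))"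

end

theory Submission
  imports Defs
begin

text \<open>A polynomial in operators is built from constants and coordinates by sums and products,
  so it has a first-order expansion whose error is quadratic in \<open>\<Sum>\<^sub>i \<parallel>T\<^sub>i\<parallel>\<close>, and the linear terms
  are necessarily the partial derivatives. By Cauchy-Schwarz the cross terms hidden in
  \<open>(\<Sum>\<^sub>i \<parallel>T\<^sub>i\<parallel>)\<^sup>2\<close> are absorbed into \<open>m \<Sum>\<^sub>i \<parallel>T\<^sub>i\<parallel>\<^sup>2\<close>, which splits into one remainder
  per operator.\<close>

section \<open>Calculus of first-order expansions\<close>

text \<open>A fixed radius and one constant \<open>C\<close> replace a Landau symbol, so constants
  can be combined explicitly under sums and products. Perturbations outside \<open>I\<close> are not
  measured: the bound also says that altering \<open>S\<close> only there leaves the value of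
  \<open>f\<close> unchanged.\<close>

definition first_order_expansion ::
    "'i set \<Rightarrow> ('i \<Rightarrow> 'b::real_normed_vector) \<Rightarrow> (('i \<Rightarrow> 'b) \<Rightarrow> 'c::real_normed_vector) \<Rightarrow>
      ('i \<Rightarrow> 'b \<Rightarrow> 'c) \<Rightarrow> bool"
  where "first_order_expansion I S f D \<longleftrightarrow>
    (\<forall>i\<in>I. bounded_linear (D i)) \<and>
    (\<exists>C\<ge>0. \<forall>T. (\<Sum>i\<in>I. norm (T i)) \<le> 1 \<longrightarrow>
      norm (f (\<lambda>i. S i + T i) - f S - (\<Sum>i\<in>I. D i (T i))) \<le> C * (\<Sum>i\<in>I. norm (T i))\<^sup>2)"

lemma first_order_expansionE:
  assumes "first_order_expansion I S f D"
  obtains C where "C \<ge> 0" "\<And>T. (\<Sum>i\<in>I. norm (T i)) \<le> 1 \<Longrightarrow>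
    norm (f (\<lambda>i. S i + T i) - f S - (\<Sum>i\<in>I. D i (T i))) \<le> C * (\<Sum>i\<in>I. norm (T i))\<^sup>2"
  using assms by (auto simp: first_order_expansion_def)

lemma first_order_expansion_bounded_linear:
  "first_order_expansion I S f D \<Longrightarrow> i \<in> I \<Longrightarrow> bounded_linear (D i)"
  by (simp add: first_order_expansion_def)

lemma first_order_expansion_const: "first_order_expansion I S (\<lambda>_. c) (\<lambda>_ _. 0)"
  by (auto simp: first_order_expansion_def intro!: exI[of _ 0])

lemma first_order_expansion_coordinate:
  fixes S :: "'i \<Rightarrow> 'b::real_normed_vector"
  assumes "finite I" "i \<in> I"
  shows "first_order_expansion I S (\<lambda>X. X i) (\<lambda>j. if j = i then (\<lambda>X. X) else (\<lambda>_. 0))"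
proof -
  have "(\<Sum>j\<in>I. (if j = i then (\<lambda>X. X) else (\<lambda>_. 0)) (T j)) = T i" for T :: "'i \<Rightarrow> 'b"
    using assms by (simp add: if_distribR sum.delta)
  then show ?thesis
    by (auto simp: first_order_expansion_def bounded_linear_ident intro!: exI[of _ 0])
qed

lemma first_order_expansion_add:
  assumes f: "first_order_expansion I S f D" and g: "first_order_expansion I S g E"
  shows "first_order_expansion I S (\<lambda>X. f X + g X) (\<lambda>i X. D i X + E i X)"
proof -
  obtain C where C: "C \<ge> 0" "\<And>T. (\<Sum>i\<in>I. norm (T i)) \<le> 1 \<Longrightarrow>
    norm (f (\<lambda>i. S i + T i) - f S - (\<Sum>i\<in>I. D i (T i))) \<le> C * (\<Sum>i\<in>I. norm (T i))\<^sup>2"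
    using f by (rule first_order_expansionE) blast
  obtain C' where C': "C' \<ge> 0" "\<And>T. (\<Sum>i\<in>I. norm (T i)) \<le> 1 \<Longrightarrow>
    norm (g (\<lambda>i. S i + T i) - g S - (\<Sum>i\<in>I. E i (T i))) \<le> C' * (\<Sum>i\<in>I. norm (T i))\<^sup>2"
    using g by (rule first_order_expansionE) blast
  have "norm (f (\<lambda>i. S i + T i) + g (\<lambda>i. S i + T i) - (f S + g S)
      - (\<Sum>i\<in>I. D i (T i) + E i (T i))) \<le> (C + C') * (\<Sum>i\<in>I. norm (T i))\<^sup>2"
    if "(\<Sum>i\<in>I. norm (T i)) \<le> 1" for T
  proof -
    have "f (\<lambda>i. S i + T i) + g (\<lambda>i. S i + T i) - (f S + g S) - (\<Sum>i\<in>I. D i (T i) + E i (T i))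
      = (f (\<lambda>i. S i + T i) - f S - (\<Sum>i\<in>I. D i (T i)))
        + (g (\<lambda>i. S i + T i) - g S - (\<Sum>i\<in>I. E i (T i)))"
      by (simp add: sum.distrib)
    also have "norm \<dots> \<le> (C + C') * (\<Sum>i\<in>I. norm (T i))\<^sup>2"
      using C(2)[OF that] C'(2)[OF that] by (simp add: norm_triangle_le distrib_right)
    finally show ?thesis .
  qed
  moreover have "\<forall>i\<in>I. bounded_linear (\<lambda>X. D i X + E i X)"
    using f g by (simp add: first_order_expansion_def bounded_linear_add)
  ultimately show ?thesis
    unfolding first_order_expansion_def using C(1) C'(1) by (intro conjI exI[of _ "C + C'"]) auto
qed

text \<open>The sum of the operator norms dominates each of them, hence serves as a single constant
  for all \<open>D i\<close>.\<close>

lemma norm_sum_bounded_linear_le: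
  assumes "finite I" "\<And>i. i \<in> I \<Longrightarrow> bounded_linear (D i)"
  obtains K where "K \<ge> 0" "\<And>T. norm (\<Sum>i\<in>I. D i (T i)) \<le> K * (\<Sum>i\<in>I. norm (T i))"
proof
  show "(\<Sum>i\<in>I. onorm (D i)) \<ge> 0"
    by (intro sum_nonneg onorm_pos_le assms(2))
  fix T
  have "norm (D i (T i)) \<le> (\<Sum>j\<in>I. onorm (D j)) * norm (T i)" if "i \<in> I" for i
  proof -
    have "onorm (D i) \<le> (\<Sum>j\<in>I. onorm (D j))"
      using assms that by (intro member_le_sum onorm_pos_le) auto
    then have "onorm (D i) * norm (T i) \<le> (\<Sum>j\<in>I. onorm (D j)) * norm (T i)"
      by (rule mult_right_mono) simp
    then show ?thesis
      using onorm[OF assms(2)[OF that], of "T i"] by linarith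
  qed
  then show "norm (\<Sum>i\<in>I. D i (T i)) \<le> (\<Sum>i\<in>I. onorm (D i)) * (\<Sum>i\<in>I. norm (T i))"
    unfolding sum_distrib_left by (rule sum_norm_le)
qed

text \<open>The linear part is bounded and the quadratic error is at most linear inside the radius.
  This controls the product of two increments in the product rule.\<close>

lemma first_order_expansion_lipschitz:
  assumes "finite I" and f: "first_order_expansion I S f D"
  obtains K where "K \<ge> 0" "\<And>T. (\<Sum>i\<in>I. norm (T i)) \<le> 1 \<Longrightarrow>
    norm (f (\<lambda>i. S i + T i) - f S) \<le> K * (\<Sum>i\<in>I. norm (T i))"
proof -
  obtain C where C: "C \<ge> 0" "\<And>T. (\<Sum>i\<in>I. norm (T i)) \<le> 1 \<Longrightarrow>
    norm (f (\<lambda>i. S i + T i) - f S - (\<Sum>i\<in>I. D i (T i))) \<le> C * (\<Sum>i\<in>I. norm (T i))\<^sup>2"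
    using f by (rule first_order_expansionE) blast
  obtain K where K: "K \<ge> 0" "\<And>T. norm (\<Sum>i\<in>I. D i (T i)) \<le> K * (\<Sum>i\<in>I. norm (T i))"
    using norm_sum_bounded_linear_le[OF assms(1), of D] first_order_expansion_bounded_linear[OF f]
    by metis
  have "norm (f (\<lambda>i. S i + T i) - f S) \<le> (C + K) * (\<Sum>i\<in>I. norm (T i))"
    if le1: "(\<Sum>i\<in>I. norm (T i)) \<le> 1" for T
  proof -
    let ?N = "\<Sum>i\<in>I. norm (T i)"
    have "norm (f (\<lambda>i. S i + T i) - f S) \<le> C * ?N\<^sup>2 + K * ?N"
      using C(2)[OF le1] K(2)[of T] norm_triangle_sub[of "f (\<lambda>i. S i + T i) - f S" "\<Sum>i\<in>I. D i (T i)"]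
      by linarith
    \<comment> \<open>Here the radius 1 matters: squaring does not increase a number in the unit
      interval.\<close>
    also have "?N\<^sup>2 \<le> ?N"
      using le1 by (simp add: power2_eq_square mult_left_le sum_nonneg)
    then have "C * ?N\<^sup>2 + K * ?N \<le> (C + K) * ?N"
      using C(1) by (simp add: distrib_right mult_left_mono)
    finally show ?thesis .
  qed
  with C(1) K(1) show thesis
    by (intro that[of "C + K"]) auto
qed

text \<open>Leibniz rule with the order of factors kept, since operators need not commute. Besides
  the two given errors, multiplied by \<open>g S\<close> and \<open>f S\<close>, only the product of
  the two increments remains, and it is quadratic by the Lipschitz bounds.\<close>

lemma first_order_expansion_mult:
  fixes f g :: "('i \<Rightarrow> 'b::real_normed_vector) \<Rightarrow> 'c::real_normed_algebra"
  assumes "finite I" and f: "first_order_expansion I S f D" and g: "first_order_expansion I S g E"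
  shows "first_order_expansion I S (\<lambda>X. f X * g X) (\<lambda>i X. D i X * g S + f S * E i X)"
proof -
  obtain C where C: "C \<ge> 0" "\<And>T. (\<Sum>i\<in>I. norm (T i)) \<le> 1 \<Longrightarrow>
    norm (f (\<lambda>i. S i + T i) - f S - (\<Sum>i\<in>I. D i (T i))) \<le> C * (\<Sum>i\<in>I. norm (T i))\<^sup>2"
    using f by (rule first_order_expansionE) blast
  obtain C' where C': "C' \<ge> 0" "\<And>T. (\<Sum>i\<in>I. norm (T i)) \<le> 1 \<Longrightarrow>
    norm (g (\<lambda>i. S i + T i) - g S - (\<Sum>i\<in>I. E i (T i))) \<le> C' * (\<Sum>i\<in>I. norm (T i))\<^sup>2"
    using g by (rule first_order_expansionE) blast
  obtain K where K: "K \<ge> 0" "\<And>T. (\<Sum>i\<in>I. norm (T i)) \<le> 1 \<Longrightarrow>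
    norm (f (\<lambda>i. S i + T i) - f S) \<le> K * (\<Sum>i\<in>I. norm (T i))"
    by (rule first_order_expansion_lipschitz[OF assms(1) f]) blast
  obtain K' where K': "K' \<ge> 0" "\<And>T. (\<Sum>i\<in>I. norm (T i)) \<le> 1 \<Longrightarrow>
    norm (g (\<lambda>i. S i + T i) - g S) \<le> K' * (\<Sum>i\<in>I. norm (T i))"
    by (rule first_order_expansion_lipschitz[OF assms(1) g]) blast
  let ?C = "C * norm (g S) + norm (f S) * C' + K * K'"
  have "norm (f (\<lambda>i. S i + T i) * g (\<lambda>i. S i + T i) - f S * g S
      - (\<Sum>i\<in>I. D i (T i) * g S + f S * E i (T i))) \<le> ?C * (\<Sum>i\<in>I. norm (T i))\<^sup>2"
    if le1: "(\<Sum>i\<in>I. norm (T i)) \<le> 1" for T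
  proof -
    define N where "N = (\<Sum>i\<in>I. norm (T i))"
    define a where "a = f (\<lambda>i. S i + T i) - f S"
    define b where "b = g (\<lambda>i. S i + T i) - g S"
    define r where "r = a - (\<Sum>i\<in>I. D i (T i))"
    define s where "s = b - (\<Sum>i\<in>I. E i (T i))"
    have "N \<ge> 0"
      by (simp add: N_def sum_nonneg)
    have r: "norm r \<le> C * N\<^sup>2" and s: "norm s \<le> C' * N\<^sup>2"
      and a: "norm a \<le> K * N" and b: "norm b \<le> K' * N"
      using C(2)[OF le1] C'(2)[OF le1] K(2)[OF le1] K'(2)[OF le1]
      by (simp_all add: r_def s_def a_def b_def N_def)
    \<comment> \<open>Exact splitting of the error, with increments \<open>a\<close>,
      \<open>b\<close> and their nonlinear parts \<open>r\<close>, \<open>s\<close>; the three terms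
      give the three summands of \<open>?C\<close>.\<close>
    have "f (\<lambda>i. S i + T i) * g (\<lambda>i. S i + T i) - f S * g S
      - (\<Sum>i\<in>I. D i (T i) * g S + f S * E i (T i)) = r * g S + f S * s + a * b"
      by (simp add: r_def s_def a_def b_def sum.distrib flip: sum_distrib_left sum_distrib_right)
        (simp add: algebra_simps)
    also have "norm \<dots> \<le> norm (r * g S) + norm (f S * s) + norm (a * b)"
      by (meson add_mono norm_triangle_ineq norm_triangle_le order_refl)
    also have "\<dots> \<le> norm r * norm (g S) + norm (f S) * norm s + norm a * norm b"
      by (intro add_mono norm_mult_ineq)
    also have "\<dots> \<le> C * N\<^sup>2 * norm (g S) + norm (f S) * (C' * N\<^sup>2) + K * N * (K' * N)"
      using C(1) C'(1) K(1) \<open>N \<ge> 0\<close> by (intro add_mono mult_mono r s a b) auto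
    also have "\<dots> = ?C * N\<^sup>2"
      by (simp add: algebra_simps power2_eq_square)
    finally show ?thesis
      by (simp add: N_def)
  qed
  moreover have "\<forall>i\<in>I. bounded_linear (\<lambda>X. D i X * g S + f S * E i X)"
    using f g by (auto simp: first_order_expansion_def intro!: bounded_linear_add
        bounded_linear_mult_const bounded_linear_const_mult)
  moreover have "?C \<ge> 0"
    using C(1) C'(1) K(1) K'(1) by simp
  ultimately show ?thesis
    unfolding first_order_expansion_def by blast
qed

section \<open>Expansion of polynomials\<close>

lemma first_order_expansion_sum:
  assumes "\<And>k. k \<in> A \<Longrightarrow> \<exists>D. first_order_expansion I S (f k) D"
  shows "\<exists>D. first_order_expansion I S (\<lambda>X. \<Sum>k\<in>A. f k X) D"
  using assms
proof (induction A rule: infinite_finite_induct)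
  case (insert k A)
  then obtain D E where "first_order_expansion I S (f k) D"
    and "first_order_expansion I S (\<lambda>X. \<Sum>k\<in>A. f k X) E"
    using insert.IH insert.prems by blast
  from first_order_expansion_add[OF this] insert.hyps show ?case
    by auto
\<comment> \<open>Over an empty or infinite index set the sum is 0, hence constant.\<close>
qed (auto intro: first_order_expansion_const)

lemma first_order_expansion_power:
  fixes f :: "('i \<Rightarrow> 'b::real_normed_vector) \<Rightarrow> 'c::{real_normed_algebra, monoid_mult}"
  assumes "finite I" "first_order_expansion I S f D"
  shows "\<exists>E. first_order_expansion I S (\<lambda>X. f X ^ n) E"
proof (induction n)
  case (Suc n)
  then obtain E where "first_order_expansion I S (\<lambda>X. f X ^ n) E" ..
  from first_order_expansion_mult[OF assms this] show ?case
    by auto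
qed (auto intro: first_order_expansion_const)

lemma first_order_expansion_prod_list:
  fixes f :: "'k \<Rightarrow> ('i \<Rightarrow> 'b::real_normed_vector) \<Rightarrow> 'c::{real_normed_algebra, monoid_mult}"
  assumes "finite I" "\<And>k. k \<in> set ks \<Longrightarrow> \<exists>D. first_order_expansion I S (f k) D"
  shows "\<exists>D. first_order_expansion I S (\<lambda>X. \<Prod>k\<leftarrow>ks. f k X) D"
  using assms(2)
proof (induction ks)
  case (Cons k ks)
  then obtain D E where "first_order_expansion I S (f k) D"
    and "first_order_expansion I S (\<lambda>X. \<Prod>k\<leftarrow>ks. f k X) E"
    using Cons.IH Cons.prems by (meson list.set_intros)
  from first_order_expansion_mult[OF assms(1) this] show ?case
    by auto
qed (auto intro: first_order_expansion_const)

lemma first_order_expansion_poly_eval: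
  fixes S :: "nat \<Rightarrow> 'b::{real_normed_algebra, complex_unital_algebra}"
  shows "\<exists>D. first_order_expansion {1..m} S (poly_eval m p) D"
proof -
  have "\<exists>D. first_order_expansion {1..m} S
      (\<lambda>X. c *\<^sub>C (\<Prod>i\<leftarrow>[1..<Suc m]. X i ^ Poly_Mapping.lookup k i)) D" for c k
  proof -
    have "\<exists>D. first_order_expansion {1..m} S (\<lambda>X. X i ^ Poly_Mapping.lookup k i) D"
      if "i \<in> set [1..<Suc m]" for i
      using that by (intro first_order_expansion_power[OF _ first_order_expansion_coordinate]) auto
    then obtain D where D: "first_order_expansion {1..m} S
        (\<lambda>X. \<Prod>i\<leftarrow>[1..<Suc m]. X i ^ Poly_Mapping.lookup k i) D"
      using first_order_expansion_prod_list[where ks = "[1..<Suc m]" and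
          f = "\<lambda>i X. X i ^ Poly_Mapping.lookup k i" and I = "{1..m}" and S = S] by auto
    \<comment> \<open>The coefficient enters as multiplication by the constant
      \<open>c *\<^sub>C 1\<close>, so the product rule also covers scalars.\<close>
    from first_order_expansion_mult[OF finite_atLeastAtMost
        first_order_expansion_const[of _ _ "c *\<^sub>C 1"] D]
    show ?thesis
      by (auto simp: mult_scaleC_left)
  qed
  then show ?thesis
    unfolding poly_eval_def by (rule first_order_expansion_sum)
qed

section \<open>Linear terms are partial derivatives\<close>

text \<open>Perturbing the \<open>i\<close>th coordinate alone turns the expansion into
  differentiability with derivative \<open>D i\<close>; uniqueness of the derivative does the
  rest.\<close>

lemma first_order_expansion_partial_frechet:
  assumes "finite I" "i \<in> I" and f: "first_order_expansion I S f D"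
  shows "partial_frechet f i S = D i"
proof -
  obtain C where C: "C \<ge> 0" "\<And>T. (\<Sum>i\<in>I. norm (T i)) \<le> 1 \<Longrightarrow>
    norm (f (\<lambda>i. S i + T i) - f S - (\<Sum>i\<in>I. D i (T i))) \<le> C * (\<Sum>i\<in>I. norm (T i))\<^sup>2"
    using f by (rule first_order_expansionE) blast
  note lin = first_order_expansion_bounded_linear[OF f]
  have bound: "norm (f (S(i := S i + h)) - f S - D i h) \<le> C * (norm h)\<^sup>2" if "norm h \<le> 1" for h
  proof -
    define T where "T = (\<lambda>j. if j = i then h else 0)"
    have "(\<Sum>j\<in>I. norm (T j)) = (\<Sum>j\<in>I. if j = i then norm h else 0)"
      by (intro sum.cong) (auto simp: T_def)
    then have N: "(\<Sum>j\<in>I. norm (T j)) = norm h"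
      using assms by simp
    have "(\<Sum>j\<in>I. D j (T j)) = (\<Sum>j\<in>I. if j = i then D i h else 0)"
      using lin by (intro sum.cong) (auto simp: T_def linear_simps)
    then have L: "(\<Sum>j\<in>I. D j (T j)) = D i h"
      using assms by simp
    have "(\<lambda>j. S j + T j) = S(i := S i + h)"
      by (auto simp: T_def)
    then show ?thesis
      using C(2)[of T] that N L by simp
  qed
  have "((\<lambda>X. f (S(i := X))) has_derivative D i) (at (S i))"
    unfolding has_derivative_at
  proof (intro conjI lin[OF assms(2)])
    have lim: "((\<lambda>h. C * norm h) \<longlongrightarrow> 0) (at 0)"
      by (auto intro!: tendsto_eq_intros)
    \<comment> \<open>Dividing the quadratic bound by \<open>norm h\<close> leaves a linear majorant
      of the difference quotient.\<close>
    have "\<forall>\<^sub>F h in at 0. norm (norm (f (S(i := S i + h)) - f (S(i := S i)) - D i h) / norm h)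
        \<le> C * norm h"
      unfolding eventually_at
    proof (intro exI[of _ 1] conjI ballI impI)
      fix h :: 'a assume h: "h \<noteq> 0 \<and> dist h 0 < 1"
      then show "norm (norm (f (S(i := S i + h)) - f (S(i := S i)) - D i h) / norm h) \<le> C * norm h"
        using bound[of h] by (simp add: divide_le_eq power2_eq_square mult.assoc)
    qed simp
    then show "((\<lambda>h. norm (f (S(i := S i + h)) - f (S(i := S i)) - D i h) / norm h) \<longlongrightarrow> 0) (at 0)"
      using lim by (rule Lim_null_comparison)
  qed
  from frechet_derivative_at[OF this] show ?thesis
    by (simp add: partial_frechet_def)
qed

section \<open>The perturbation bound\<close>

text \<open>Each coordinate tends to 0 along the filter, hence so does the finite sum of norms. Thus
  the expansion bound is eventually available.\<close>

lemma eventually_tuple_to_zero: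
  "\<forall>\<^sub>F T in tuple_to_zero m. (\<Sum>i=1..m. norm (T i)) \<le> 1"
proof -
  have "((\<lambda>T. T i) \<longlongrightarrow> 0) (tuple_to_zero m)" if "i \<in> {1..m}" for i
    unfolding tuple_to_zero_def
    by (rule filterlim_mono[OF filterlim_filtercomap order_refl]) (rule INF_lower[OF that])
  then have "((\<lambda>T. \<Sum>i=1..m. norm (T i)) \<longlongrightarrow> (\<Sum>i=1..m. 0)) (tuple_to_zero m)"
    by (intro tendsto_sum tendsto_norm_zero)
  then have "\<forall>\<^sub>F T in tuple_to_zero m. (\<Sum>i=1..m. norm (T i)) < 1"
    by (intro order_tendstoD(2)[of _ 0]) auto
  then show ?thesis
    by (rule eventually_mono) simp
qed

lemma norm_endo_apply_le: "norm (endo_apply f x) \<le> norm f * norm x"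
  by transfer (rule norm_blinfun)

lemma endo_apply_diff: "endo_apply (f - g) x = endo_apply f x - endo_apply g x"
  by transfer (rule blinfun.diff_left)

text \<open>The estimate is first proved for operator norms and applied to \<open>x\<close> only at
  the end, so the remainders do not depend on \<open>x\<close>.\<close>

theorem theorem3:
  fixes m :: nat
    and g :: "nat \<Rightarrow> 'r::{complex_unital_algebra, comm_ring, comm_monoid_mult}"
    and \<rho> :: "'r \<Rightarrow> 'a::complex_inner endo"
    and S :: "nat \<Rightarrow> 'a endo"
    and p :: "(nat \<Rightarrow>\<^sub>0 nat) \<Rightarrow>\<^sub>0 complex"
  assumes "generates m g"
    and "unital_algebra_hom \<rho>"
    and "\<And>i. i \<in> {1..m} \<Longrightarrow> \<rho> (g i) = S i"
    and "p \<in> polys m"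
  shows "\<exists>R :: nat \<Rightarrow> (nat \<Rightarrow> 'a endo) \<Rightarrow> real.
    (\<forall>i\<in>{1..m}. R i \<in> O[tuple_to_zero m](\<lambda>T. (norm (T i))\<^sup>2)) \<and>
    (\<forall>T x. norm (endo_apply (poly_eval m p S) x - endo_apply (poly_eval m p (\<lambda>i. S i + T i)) x)
      \<le> norm x * (\<Sum>i=1..m. norm (partial_frechet (poly_eval m p) i S (T i)) + R i T))"
proof -
  let ?f = "poly_eval m p"
  obtain D where D: "first_order_expansion {1..m} S ?f D"
    using first_order_expansion_poly_eval by blast
  have pf: "partial_frechet ?f i S = D i" if "i \<in> {1..m}" for i
    using first_order_expansion_partial_frechet[OF _ that D] by simp
  obtain C where C: "C \<ge> 0" "\<And>T. (\<Sum>i=1..m. norm (T i)) \<le> 1 \<Longrightarrow>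
      norm (?f (\<lambda>i. S i + T i) - ?f S - (\<Sum>i=1..m. D i (T i))) \<le> C * (\<Sum>i=1..m. norm (T i))\<^sup>2"
    using D by (rule first_order_expansionE) blast
  \<comment> \<open>Away from \<open>0\<close> the remainder is unconstrained, so there it is the whole left-hand side.\<close>
  define R where "R i T = (if (\<Sum>i=1..m. norm (T i)) \<le> 1 then C * m * (norm (T i))\<^sup>2
      else norm (?f S - ?f (\<lambda>i. S i + T i)))" for i :: nat and T
  have R_nonneg: "R i T \<ge> 0" for i T
    using C(1) by (simp add: R_def)
  have "R i \<in> O[tuple_to_zero m](\<lambda>T. (norm (T i))\<^sup>2)" for i
    using C(1) by (intro bigoI[where c = "C * m"] eventually_mono[OF eventually_tuple_to_zero])
      (auto simp: R_def)
  moreover have "norm (endo_apply (?f S) x - endo_apply (?f (\<lambda>i. S i + T i)) x)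
      \<le> norm x * (\<Sum>i=1..m. norm (partial_frechet ?f i S (T i)) + R i T)" for T x
  proof -
    have "norm (?f S - ?f (\<lambda>i. S i + T i)) \<le> (\<Sum>i=1..m. norm (D i (T i)) + R i T)"
    proof (cases "(\<Sum>i=1..m. norm (T i)) \<le> 1")
      case True
      have "norm (?f S - ?f (\<lambda>i. S i + T i)) = norm (?f (\<lambda>i. S i + T i) - ?f S)"
        by (rule norm_minus_commute)
      also have "\<dots> \<le> norm (\<Sum>i=1..m. D i (T i)) + C * (\<Sum>i=1..m. norm (T i))\<^sup>2"
        using C(2)[OF True] norm_triangle_sub[of "?f (\<lambda>i. S i + T i) - ?f S" "\<Sum>i=1..m. D i (T i)"]
        by linarith
      \<comment> \<open>Cauchy-Schwarz against the all-ones vector, whence the factor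
        \<open>m\<close> in \<open>R\<close>.\<close>
      also have "\<dots> \<le> (\<Sum>i=1..m. norm (D i (T i))) + C * ((\<Sum>i=1..m. (norm (T i))\<^sup>2) * m)"
        using C(1) sum_squared_le_sum_of_squares[of "\<lambda>i. norm (T i)" "{1..m}"]
        by (intro add_mono norm_sum mult_left_mono) auto
      also have "\<dots> = (\<Sum>i=1..m. norm (D i (T i)) + R i T)"
        using True by (simp add: R_def sum.distrib sum_distrib_left sum_distrib_right mult_ac)
      finally show ?thesis .
    next
      case False
      \<comment> \<open>An empty sum could not exceed 1, so index 1 exists. Its remainder alone
        equals the whole operator norm to be bounded, and all other terms are nonnegative.\<close>
      then have "m \<ge> 1"
        by (cases m) auto
      then have "R 1 T \<le> (\<Sum>i=1..m. R i T)"
        using R_nonneg by (intro member_le_sum) auto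
      also have "\<dots> \<le> (\<Sum>i=1..m. norm (D i (T i)) + R i T)"
        by (intro sum_mono) simp
      finally show ?thesis
        using False by (simp add: R_def)
    qed
    then have "norm (?f S - ?f (\<lambda>i. S i + T i)) * norm x
        \<le> (\<Sum>i=1..m. norm (partial_frechet ?f i S (T i)) + R i T) * norm x"
      by (intro mult_right_mono) (simp_all add: pf)
    then show ?thesis
      unfolding endo_apply_diff[symmetric]
      using norm_endo_apply_le[of "?f S - ?f (\<lambda>i. S i + T i)" x] by (simp add: mult.commute)
  qed
  ultimately show ?thesis
    by blast
qed

end
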